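(* Let $(X,R,\tau)$ be a GCOTS (respectively, $(X,\leq,\tau)$ a GLOTS) and let $Y$ be a COTS (respectively, a LOTS) with a precompact convex uniformity $\mu$ compatible with its (interval) topology. Then: (1) Every order preserving (i.e. COP, respectively LOP; not necessarily continuous) map $f:(X,\tau)\to(Y,\mu)$ is fragmented. (2) If, in addition, $(X,\tau)$ is Polish and $\mu$ is metrizable and separable, then $f:(X,\tau)\to Y$ is of Baire class 1.
   Context: A circular order on a set $X$ is a ternary relation $R\subseteq X^3$ (write $[a,b,c]$ for $(a,b,c)\in R$) satisfying: cyclicity ($[a,b,c]\Rightarrow[b,c,a]$); asymmetry ($[a,b,c]\Rightarrow (c,b,a)\notin R$); transitivity ($[a,b,c]$ and $[a,c,d]$ imply $[a,b,d]$); totality (if $a,b,c$ are distinct then $[a,b,c]$ or $[a,c,b]$). Put $(a,b)_R:=\{x\in X:[a,x,b]\}$ and $[a,b]_R:=(a,b)_R\cup\{a,b\}$. The interval topology $\lambda_R$ is the topology on $X$ with base $\{X\setminus[a,b]_R: a,b\in X\}\cup\{X\}$. A COTS (LOTS) is a circularly (linearly) ordered set with its interval topology (for linear orders: generated by the open rays). A GCOTS is a triple $(X,R,\tau)$ with $R$ a circular order and $\tau$ a topology on $X$ such that there are a COTS $(Y,R_Y)$ and an injection $i:X\to Y$ which is a topological embedding of $(X,\tau)$ into $(Y,\lambda_{R_Y})$ and satisfies $[a,b,c]_R\iff[i(a),i(b),i(c)]_{R_Y}$. A GLOTS $(X,\leq,\tau)$ is defined in the same way with linear orders. COP map $f:X_1\to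 X_2$: (COP1) whenever $[a,b,c]$ in $X_1$ and $f(a),f(b),f(c)$ are pairwise distinct, then $[f(a),f(b),f(c)]$ in $X_2$; (COP2) if $f(x)=f(y)$ then $f$ is constant on one of the closed intervals $[x,y]$, $[y,x]$. LOP map: $x\leq x'$ implies $f(x)\leq f(x')$. A subset $C$ of a circularly ordered set is convex if for all $a,b\in C$ at least one of $[a,b]_R$, $[b,a]_R$ is contained in $C$ (for linear orders: usual order-convexity). A (Hausdorff) uniformity is convex if it has a base of uniform covers with convex members; precompact if it has a base of finite uniform covers. A map $f:X\to(Y,\mu)$ from a topological space to a uniform space is fragmented if for every entourage $\varepsilon\in\mu$ and every nonempty $A\subseteq X$ there is a nonempty relatively open $O\subseteq A$ with $f(O)\times f(O)\subseteq\varepsilon$. A map $f$ is of Baire class 1 if the preimage of every open set is an $F_\sigma$ set. *)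

theory Defs
  imports "HOL-Analysis.Analysis"
begin

section \<open>Circular and linear orders with their interval topologies\<close>

definition circular_order_on :: "'a set \<Rightarrow> ('a \<times> 'a \<times> 'a) set \<Rightarrow> bool" where
  "circular_order_on X R \<longleftrightarrow>
     R \<subseteq> X \<times> X \<times> X \<and>
     (\<forall>a b c. (a, b, c) \<in> R \<longrightarrow> (b, c, a) \<in> R) \<and>
     (\<forall>a b c. (a, b, c) \<in> R \<longrightarrow> (c, b, a) \<notin> R) \<and>
     (\<forall>a b c d. (a, b, c) \<in> R \<longrightarrow> (a, c, d) \<in> R \<longrightarrow> (a, b, d) \<in> R) \<and>
     (\<forall>a\<in>X. \<forall>b\<in>X. \<forall>c\<in>X. a \<noteq> b \<longrightarrow> b \<noteq> c \<longrightarrow> a \<noteq> c \<longrightarrow> (a, b, c) \<in> R \<or> (a, c, b) \<in> R)"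

definition circ_open_interval :: "('a \<times> 'a \<times> 'a) set \<Rightarrow> 'a \<Rightarrow> 'a \<Rightarrow> 'a set" where
  "circ_open_interval R a b = {x. (a, x, b) \<in> R}"

definition circ_closed_interval :: "('a \<times> 'a \<times> 'a) set \<Rightarrow> 'a \<Rightarrow> 'a \<Rightarrow> 'a set" where
  "circ_closed_interval R a b = circ_open_interval R a b \<union> {a, b}"

text \<open>For a circular order the generating family is closed under finite intersections up to
  unions, i.e. it is a base, so taking it as a subbase yields the same topology.\<close>

definition circ_interval_topology :: "'a set \<Rightarrow> ('a \<times> 'a \<times> 'a) set \<Rightarrow> 'a topology" where
  "circ_interval_topology X R =
     topology_generated_by (insert X {X - circ_closed_interval R a b |a b. a \<in> X \<and> b \<in> X})"

text \<open>Linear orders are relations \<open>r\<close> with \<open>linear_order_on X r\<close>, where \<open>(a, b) \<in> r\<close> means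
  \<open>a \<le> b\<close>. The carrier is added to the open rays because the rays do not cover
  a one-point set.\<close>

definition lin_interval_topology :: "'a set \<Rightarrow> 'a rel \<Rightarrow> 'a topology" where
  "lin_interval_topology X r =
     topology_generated_by
       (insert X ({{x \<in> X. (x, a) \<in> r \<and> x \<noteq> a} |a. a \<in> X} \<union> {{x \<in> X. (a, x) \<in> r \<and> x \<noteq> a} |a. a \<in> X}))"

text \<open>The type argument is the type in which the ambient ordered space lives, since HOL cannot
  quantify existentially over types. In an assumption of a theorem that is polymorphic
  in \<open>'c\<close>, it amounts to the existence of an ambient space of any type.\<close>

definition gcots ::
  "'c itself \<Rightarrow> 'a set \<Rightarrow> ('a \<times> 'a \<times> 'a) set \<Rightarrow> 'a topology \<Rightarrow> bool" where
  "gcots (_ :: 'c itself) X R T \<longleftrightarrow>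
     circular_order_on X R \<and> topspace T = X \<and>
     (\<exists>(Z :: 'c set) S i. circular_order_on Z S \<and> i \<in> X \<rightarrow> Z \<and> inj_on i X \<and>
        embedding_map T (circ_interval_topology Z S) i \<and>
        (\<forall>a\<in>X. \<forall>b\<in>X. \<forall>c\<in>X. (a, b, c) \<in> R \<longleftrightarrow> (i a, i b, i c) \<in> S))"

definition glots :: "'c itself \<Rightarrow> 'a set \<Rightarrow> 'a rel \<Rightarrow> 'a topology \<Rightarrow> bool" where
  "glots (_ :: 'c itself) X r T \<longleftrightarrow>
     linear_order_on X r \<and> topspace T = X \<and>
     (\<exists>(Z :: 'c set) s i. linear_order_on Z s \<and> i \<in> X \<rightarrow> Z \<and> inj_on i X \<and>
        embedding_map T (lin_interval_topology Z s) i \<and>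
        (\<forall>a\<in>X. \<forall>b\<in>X. (a, b) \<in> r \<longleftrightarrow> (i a, i b) \<in> s))"

section \<open>Order preserving maps and convex sets\<close>

definition cop_map ::
  "'a set \<Rightarrow> ('a \<times> 'a \<times> 'a) set \<Rightarrow> 'b set \<Rightarrow> ('b \<times> 'b \<times> 'b) set \<Rightarrow> ('a \<Rightarrow> 'b) \<Rightarrow> bool" where
  "cop_map X R Y S f \<longleftrightarrow>
     f \<in> X \<rightarrow> Y \<and>
     (\<forall>a b c. (a, b, c) \<in> R \<longrightarrow> f a \<noteq> f b \<longrightarrow> f b \<noteq> f c \<longrightarrow> f a \<noteq> f c \<longrightarrow> (f a, f b, f c) \<in> S) \<and>
     (\<forall>x\<in>X. \<forall>y\<in>X. f x = f y \<longrightarrow>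
        f constant_on circ_closed_interval R x y \<or> f constant_on circ_closed_interval R y x)"

definition lop_map :: "'a set \<Rightarrow> 'a rel \<Rightarrow> 'b set \<Rightarrow> 'b rel \<Rightarrow> ('a \<Rightarrow> 'b) \<Rightarrow> bool" where
  "lop_map X r Y s f \<longleftrightarrow> f \<in> X \<rightarrow> Y \<and> (\<forall>x x'. (x, x') \<in> r \<longrightarrow> (f x, f x') \<in> s)"

definition circ_convex :: "'a set \<Rightarrow> ('a \<times> 'a \<times> 'a) set \<Rightarrow> 'a set \<Rightarrow> bool" where
  "circ_convex X R C \<longleftrightarrow>
     C \<subseteq> X \<and>
     (\<forall>a\<in>C. \<forall>b\<in>C. circ_closed_interval R a b \<subseteq> C \<or> circ_closed_interval R b a \<subseteq> C)"

definition lin_convex :: "'a set \<Rightarrow> 'a rel \<Rightarrow> 'a set \<Rightarrow> bool" where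
  "lin_convex X r C \<longleftrightarrow>
     C \<subseteq> X \<and> (\<forall>a\<in>C. \<forall>b\<in>C. \<forall>x\<in>X. (a, x) \<in> r \<longrightarrow> (x, b) \<in> r \<longrightarrow> x \<in> C)"

section \<open>Uniformities on a carrier set\<close>

definition uniformity_on :: "'a set \<Rightarrow> 'a rel set \<Rightarrow> bool" where
  "uniformity_on Y U \<longleftrightarrow>
     Y \<times> Y \<in> U \<and>
     (\<forall>E\<in>U. Id_on Y \<subseteq> E \<and> E \<subseteq> Y \<times> Y) \<and>
     (\<forall>E\<in>U. \<forall>D. E \<subseteq> D \<longrightarrow> D \<subseteq> Y \<times> Y \<longrightarrow> D \<in> U) \<and>
     (\<forall>E\<in>U. \<forall>D\<in>U. E \<inter> D \<in> U) \<and>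
     (\<forall>E\<in>U. E\<inverse> \<in> U) \<and>
     (\<forall>E\<in>U. \<exists>D\<in>U. D O D \<subseteq> E)"

definition hausdorff_uniformity_on :: "'a set \<Rightarrow> 'a rel set \<Rightarrow> bool" where
  "hausdorff_uniformity_on Y U \<longleftrightarrow> uniformity_on Y U \<and> \<Inter>U = Id_on Y"

definition uniform_topology :: "'a set \<Rightarrow> 'a rel set \<Rightarrow> 'a topology" where
  "uniform_topology Y U = topology (\<lambda>V. V \<subseteq> Y \<and> (\<forall>x\<in>V. \<exists>E\<in>U. E `` {x} \<subseteq> V))"

lemma openin_uniform_topology:
  assumes "uniformity_on Y U"
  shows "openin (uniform_topology Y U) V \<longleftrightarrow> V \<subseteq> Y \<and> (\<forall>x\<in>V. \<exists>E\<in>U. E `` {x} \<subseteq> V)"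
proof -
  have int: "\<exists>E\<in>U. E `` {x} \<subseteq> V \<inter> W"
    if "\<exists>E\<in>U. E `` {x} \<subseteq> V" "\<exists>E\<in>U. E `` {x} \<subseteq> W" for x V W
  proof -
    obtain E D where "E \<in> U" "E `` {x} \<subseteq> V" "D \<in> U" "D `` {x} \<subseteq> W"
      using \<open>\<exists>E\<in>U. E `` {x} \<subseteq> V\<close> \<open>\<exists>E\<in>U. E `` {x} \<subseteq> W\<close> by blast
    moreover from this have "E \<inter> D \<in> U"
      using assms by (simp add: uniformity_on_def)
    ultimately show ?thesis by blast
  qed
  have "istopology (\<lambda>V. V \<subseteq> Y \<and> (\<forall>x\<in>V. \<exists>E\<in>U. E `` {x} \<subseteq> V))"
    unfolding istopology_def
  proof (intro conjI allI impI)
    fix V W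
    assume "V \<subseteq> Y \<and> (\<forall>x\<in>V. \<exists>E\<in>U. E `` {x} \<subseteq> V)" "W \<subseteq> Y \<and> (\<forall>x\<in>W. \<exists>E\<in>U. E `` {x} \<subseteq> W)"
    then show "V \<inter> W \<subseteq> Y" "\<forall>x\<in>V \<inter> W. \<exists>E\<in>U. E `` {x} \<subseteq> V \<inter> W"
      using int by auto
  next
    fix K
    assume *: "\<forall>V\<in>K. V \<subseteq> Y \<and> (\<forall>x\<in>V. \<exists>E\<in>U. E `` {x} \<subseteq> V)"
    then show "\<Union>K \<subseteq> Y" by blast
    show "\<forall>x\<in>\<Union>K. \<exists>E\<in>U. E `` {x} \<subseteq> \<Union>K"
    proof
      fix x assume "x \<in> \<Union>K"
      then obtain V where "V \<in> K" "x \<in> V" by blast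
      moreover from this * obtain E where "E \<in> U" "E `` {x} \<subseteq> V" by blast
      ultimately show "\<exists>E\<in>U. E `` {x} \<subseteq> \<Union>K" by blast
    qed
  qed
  then show ?thesis
    by (simp add: uniform_topology_def topology_inverse')
qed

definition uniform_cover :: "'a set \<Rightarrow> 'a rel set \<Rightarrow> 'a set set \<Rightarrow> bool" where
  "uniform_cover Y U \<C> \<longleftrightarrow>
     (\<forall>A\<in>\<C>. A \<subseteq> Y) \<and> \<Union>\<C> = Y \<and> (\<exists>E\<in>U. \<forall>x\<in>Y. \<exists>A\<in>\<C>. E `` {x} \<subseteq> A)"

definition uniform_cover_base :: "'a set \<Rightarrow> 'a rel set \<Rightarrow> 'a set set set \<Rightarrow> bool" where
  "uniform_cover_base Y U \<BB> \<longleftrightarrow>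
     (\<forall>\<C>\<in>\<BB>. uniform_cover Y U \<C>) \<and>
     (\<forall>\<C>. uniform_cover Y U \<C> \<longrightarrow> (\<exists>\<D>\<in>\<BB>. \<forall>D\<in>\<D>. \<exists>C\<in>\<C>. D \<subseteq> C))"

definition circ_convex_uniformity ::
  "'a set \<Rightarrow> ('a \<times> 'a \<times> 'a) set \<Rightarrow> 'a rel set \<Rightarrow> bool" where
  "circ_convex_uniformity Y S U \<longleftrightarrow>
     (\<exists>\<BB>. uniform_cover_base Y U \<BB> \<and> (\<forall>\<C>\<in>\<BB>. \<forall>C\<in>\<C>. circ_convex Y S C))"

definition lin_convex_uniformity :: "'a set \<Rightarrow> 'a rel \<Rightarrow> 'a rel set \<Rightarrow> bool" where
  "lin_convex_uniformity Y s U \<longleftrightarrow>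
     (\<exists>\<BB>. uniform_cover_base Y U \<BB> \<and> (\<forall>\<C>\<in>\<BB>. \<forall>C\<in>\<C>. lin_convex Y s C))"

definition precompact_uniformity :: "'a set \<Rightarrow> 'a rel set \<Rightarrow> bool" where
  "precompact_uniformity Y U \<longleftrightarrow> (\<exists>\<BB>. uniform_cover_base Y U \<BB> \<and> (\<forall>\<C>\<in>\<BB>. finite \<C>))"

definition metrizable_uniformity :: "'a set \<Rightarrow> 'a rel set \<Rightarrow> bool" where
  "metrizable_uniformity Y U \<longleftrightarrow>
     (\<exists>d. Metric_space Y d \<and>
        U = {E. E \<subseteq> Y \<times> Y \<and> (\<exists>e>0. \<forall>x\<in>Y. \<forall>y\<in>Y. d x y < e \<longrightarrow> (x, y) \<in> E)})"

definition separable_uniformity :: "'a set \<Rightarrow> 'a rel set \<Rightarrow> bool" where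
  "separable_uniformity Y U \<longleftrightarrow> separable_space (uniform_topology Y U)"

section \<open>Fragmented maps and Baire class one\<close>

definition fragmented_map :: "'a topology \<Rightarrow> 'b rel set \<Rightarrow> ('a \<Rightarrow> 'b) \<Rightarrow> bool" where
  "fragmented_map T U f \<longleftrightarrow>
     (\<forall>E\<in>U. \<forall>A. A \<subseteq> topspace T \<longrightarrow> A \<noteq> {} \<longrightarrow>
        (\<exists>V. openin (subtopology T A) V \<and> V \<noteq> {} \<and> f ` V \<times> f ` V \<subseteq> E))"

definition polish_topology :: "'a topology \<Rightarrow> bool" where
  "polish_topology T \<longleftrightarrow> completely_metrizable_space T \<and> separable_space T"

definition baire_class_one :: "'a topology \<Rightarrow> 'b topology \<Rightarrow> ('a \<Rightarrow> 'b) \<Rightarrow> bool" where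
  "baire_class_one T S f \<longleftrightarrow>
     (\<forall>V. openin S V \<longrightarrow> fsigma_in T {x \<in> topspace T. f x \<in> V})"

end

theory Submission
  imports Defs
begin

text \<open>
  In the source space every convex set \<open>P\<close> differs from its interior by finitely many points:
  among any three points of \<open>P\<close> one lies in an open interval contained in \<open>P\<close>. Preimages of
  convex sets under order preserving maps are convex, and for each entourage finitely many small
  convex sets cover the target. Hence a nonempty set \<open>A\<close> either meets the interior of one of the
  finitely many preimages, or is finite and therefore discrete. For Baire class one, an open set
  of the target is a countable union of such small convex sets, and in a metrizable space the
  union of an open set and a finite set is \<open>F\<^sub>\<sigma>\<close>.
\<close>

section \<open>Entourages and small finite covers of the target space\<close>

lemma uniformity_onD:
  assumes "uniformity_on Y U" "E \<in> U"
  shows "E \<subseteq> Y \<times> Y" "Id_on Y \<subseteq> E" "E\<inverse> \<in> U" "\<exists>D\<in>U. D O D \<subseteq> E" "D \<in> U \<Longrightarrow> E \<inter> D \<in> U"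
  using assms unfolding uniformity_on_def by simp_all

text \<open>The cover base \<BB> yields small members with property \<open>Q\<close>, possibly
  infinitely many; precompactness yields finite covers without \<open>Q\<close>. Refining the first
  cover by a finite one and enlarging each finite piece to a \<open>Q\<close>-member containing it
  gives both at once.\<close>

lemma precompact_small_finite_cover:
  assumes U: "uniformity_on Y U" and "precompact_uniformity Y U"
    and base: "uniform_cover_base Y U \<BB>" and Q: "\<forall>\<C>\<in>\<BB>. \<forall>C\<in>\<C>. Q C"
    and "E \<in> U"
  obtains \<F> where "finite \<F>" "Y \<subseteq> \<Union>\<F>" "\<And>C. C \<in> \<F> \<Longrightarrow> C \<times> C \<subseteq> E \<and> C \<subseteq> Y \<and> Q C"
proof -
  obtain D1 where D1: "D1 \<in> U" "D1 O D1 \<subseteq> E"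
    using uniformity_onD(4)[OF U \<open>E \<in> U\<close>] by blast
  define D where "D = D1 \<inter> D1\<inverse>"
  have D: "D \<in> U" unfolding D_def using uniformity_onD(3,5)[OF U D1(1)] by simp
  note sub = uniformity_onD(1,2)[OF U D]
  let ?\<C> = "(\<lambda>x. D `` {x}) ` Y"
  have "uniform_cover Y U ?\<C>"
    unfolding uniform_cover_def
  proof (intro conjI bexI[OF _ D] ballI)
    show "A \<subseteq> Y" if "A \<in> ?\<C>" for A using that sub(1) by auto
    show "\<Union>?\<C> = Y" using sub by auto
  qed blast
  then obtain \<D> where \<D>: "\<D> \<in> \<BB>" "\<forall>B\<in>\<D>. \<exists>C\<in>?\<C>. B \<subseteq> C"
    using base unfolding uniform_cover_base_def by meson
  have small: "B \<times> B \<subseteq> E" if B: "B \<in> \<D>" for B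
  proof -
    obtain x where x: "B \<subseteq> D `` {x}" using \<D>(2) B by auto
    show ?thesis
    proof (rule subrelI)
      fix p q assume "(p, q) \<in> B \<times> B"
      then have "(p, x) \<in> D1" "(x, q) \<in> D1" using x unfolding D_def by auto
      then show "(p, q) \<in> E" using D1(2) by auto
    qed
  qed
  have cov: "uniform_cover Y U \<D>"
    using \<D>(1) base unfolding uniform_cover_base_def by simp
  then obtain \<G> where \<G>: "uniform_cover Y U \<G>" "finite \<G>" "\<forall>G\<in>\<G>. \<exists>B\<in>\<D>. G \<subseteq> B"
    using assms(2) unfolding precompact_uniformity_def uniform_cover_base_def by meson
  then obtain g where g: "\<And>G. G \<in> \<G> \<Longrightarrow> g G \<in> \<D> \<and> G \<subseteq> g G" by metis
  show thesis
  proof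
    show "finite (g ` \<G>)" using \<G> by simp
    show "Y \<subseteq> \<Union>(g ` \<G>)" using \<G>(1) g unfolding uniform_cover_def by fast
    show "C \<times> C \<subseteq> E \<and> C \<subseteq> Y \<and> Q C" if "C \<in> g ` \<G>" for C
    proof -
      have "C \<in> \<D>" using that g by auto
      then show ?thesis using small Q \<D>(1) cov unfolding uniform_cover_def by simp
    qed
  qed
qed

text \<open>The metric entourages of radius 1/(n+1) are cofinal. This countability is what later
  turns an open set of the target into a countable union of small convex sets.\<close>

lemma metrizable_uniformity_countable_base:
  assumes "metrizable_uniformity Y U"
  obtains E :: "nat \<Rightarrow> 'a rel" where "\<And>n. E n \<in> U" "\<And>D. D \<in> U \<Longrightarrow> \<exists>n. E n \<subseteq> D"
proof -
  obtain d :: "'a \<Rightarrow> 'a \<Rightarrow> real"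
    where U: "U = {E. E \<subseteq> Y \<times> Y \<and> (\<exists>e>0. \<forall>x\<in>Y. \<forall>y\<in>Y. d x y < e \<longrightarrow> (x, y) \<in> E)}"
    using assms unfolding metrizable_uniformity_def by (elim exE conjE) (rule that)
  \<comment> \<open>\<open>Suc\<close> keeps the radius positive at \<open>n = 0\<close>, where
    \<open>inverse 0\<close> would be 0.\<close>
  define E where "E n = {(x, y). x \<in> Y \<and> y \<in> Y \<and> d x y < inverse (real (Suc n))}" for n
  show thesis
  proof
    show "E n \<in> U" for n
      unfolding U E_def by (auto intro!: exI[of _ "inverse (real (Suc n))"])
    show "\<exists>n. E n \<subseteq> D" if D: "D \<in> U" for D
    proof -
      obtain e where e: "e > 0" "\<forall>x\<in>Y. \<forall>y\<in>Y. d x y < e \<longrightarrow> (x, y) \<in> D"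
        using D unfolding U by auto
      obtain n where "inverse (real (Suc n)) < e" using reals_Archimedean e(1) by blast
      then have "E n \<subseteq> D" using e(2) unfolding E_def by force
      then show ?thesis ..
    qed
  qed
qed

section \<open>From almost open preimages to fragmentedness and Baire class one\<close>

lemma fragmented_map_if_almost_open_cover:
  assumes "t1_space T"
    and cover: "\<And>E. E \<in> U \<Longrightarrow> \<exists>\<P>. finite \<P> \<and> topspace T \<subseteq> \<Union>\<P> \<and>
      (\<forall>P\<in>\<P>. f ` P \<times> f ` P \<subseteq> E \<and> finite (P - T interior_of P))"
  shows "fragmented_map T U f"
  unfolding fragmented_map_def
proof (intro ballI allI impI)
  fix E A assume "E \<in> U" and A: "A \<subseteq> topspace T" "A \<noteq> {}"
  then obtain \<P> where \<P>: "finite \<P>" "topspace T \<subseteq> \<Union>\<P>"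
    "\<And>P. P \<in> \<P> \<Longrightarrow> f ` P \<times> f ` P \<subseteq> E \<and> finite (P - T interior_of P)"
    using cover by meson
  show "\<exists>V. openin (subtopology T A) V \<and> V \<noteq> {} \<and> f ` V \<times> f ` V \<subseteq> E"
  proof (cases "\<exists>P\<in>\<P>. A \<inter> T interior_of P \<noteq> {}")
    case True
    then obtain P where P: "P \<in> \<P>" "A \<inter> T interior_of P \<noteq> {}" by blast
    have "openin (subtopology T A) (A \<inter> T interior_of P)"
      by (simp add: openin_subtopology_Int2)
    moreover have "f ` (A \<inter> T interior_of P) \<times> f ` (A \<inter> T interior_of P) \<subseteq> E"
      using \<P>(3)[OF P(1)] interior_of_subset[of T P] by blast
    ultimately show ?thesis using P(2) by blast
  next
    case False
    have "A \<subseteq> (\<Union>P\<in>\<P>. P - T interior_of P)"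
    proof
      fix x assume x: "x \<in> A"
      then obtain P where "P \<in> \<P>" "x \<in> P" using A(1) \<P>(2) by auto
      moreover have "x \<notin> T interior_of P" using False x \<open>P \<in> \<P>\<close> by auto
      ultimately show "x \<in> (\<Union>P\<in>\<P>. P - T interior_of P)" by auto
    qed
    moreover have "finite (\<Union>P\<in>\<P>. P - T interior_of P)" using \<P>(1,3) by simp
    ultimately have fin: "finite A" by (rule finite_subset)
    obtain a where a: "a \<in> A" using A by blast
    \<comment> \<open>In a T1 space the finite set \<open>A - {a}\<close> is closed, so
      \<open>{a}\<close> is relatively open in \<open>A\<close> and can serve as the
      witness.\<close>
    have "closedin T (A - {a})"
      using assms(1) fin A(1) unfolding t1_space_closedin_finite by auto
    then have "openin (subtopology T A) (A \<inter> (topspace T - (A - {a})))"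
      by (intro openin_subtopology_Int2 openin_diff) simp_all
    moreover have "A \<inter> (topspace T - (A - {a})) = {a}" using a A by blast
    \<comment> \<open>\<open>U\<close> is an arbitrary family here, so reflexivity of
      \<open>E\<close> at \<open>f a\<close> is read off from a member of the cover.\<close>
    moreover have "f ` {a} \<times> f ` {a} \<subseteq> E"
    proof -
      obtain P where "P \<in> \<P>" "a \<in> P" using a A(1) \<P>(2) by auto
      then show ?thesis using \<P>(3)[of P] by auto
    qed
    ultimately show ?thesis by (intro exI[of _ "{a}"]) simp
  qed
qed

lemma fsigma_in_if_almost_open:
  assumes "metrizable_space T" "P \<subseteq> topspace T" "finite (P - T interior_of P)"
  shows "fsigma_in T P"
proof -
  have "closedin T (P - T interior_of P)"
    using assms by (meson Diff_subset metrizable_imp_t1_space order_trans t1_space_closedin_finite)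
  then have "fsigma_in T (P - T interior_of P)" by (rule closed_imp_fsigma_in)
  moreover have "fsigma_in T (T interior_of P)"
    using assms(1) by (simp add: open_imp_fsigma_in)
  ultimately have "fsigma_in T (P - T interior_of P \<union> T interior_of P)" by (rule fsigma_in_Un)
  moreover have "P - T interior_of P \<union> T interior_of P = P"
    using interior_of_subset[of T P] by blast
  ultimately show ?thesis by simp
qed

text \<open>\<open>Q\<close> stands for circular or linear convexity, so the topological argument is
  carried out once for both; the order of the source enters through \<open>pre\<close>, the almost
  openness of preimages.\<close>

lemma fragmented_and_baire_if_almost_open_preimages:
  assumes T1: "t1_space T" and f: "f \<in> topspace T \<rightarrow> Y"
    and U: "uniformity_on Y U" "precompact_uniformity Y U"
    and base: "uniform_cover_base Y U \<BB>" "\<forall>\<C>\<in>\<BB>. \<forall>C\<in>\<C>. Q C"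
    and pre: "\<forall>C. Q C \<longrightarrow> finite ({x \<in> topspace T. f x \<in> C} - T interior_of {x \<in> topspace T. f x \<in> C})"
  shows "fragmented_map T U f"
    and "metrizable_space T \<Longrightarrow> metrizable_uniformity Y U \<Longrightarrow>
      baire_class_one T (uniform_topology Y U) f"
proof -
  let ?pre = "\<lambda>C. {x \<in> topspace T. f x \<in> C}"
  have cover: "\<exists>\<F>. finite \<F> \<and> Y \<subseteq> \<Union>\<F> \<and> (\<forall>C\<in>\<F>. C \<times> C \<subseteq> E \<and> C \<subseteq> Y \<and> Q C)"
    if E: "E \<in> U" for E
  proof -
    obtain \<F> where "finite \<F>" "Y \<subseteq> \<Union>\<F>" "\<And>C. C \<in> \<F> \<Longrightarrow> C \<times> C \<subseteq> E \<and> C \<subseteq> Y \<and> Q C"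
      using precompact_small_finite_cover[OF U base E] by blast
    then show ?thesis by (intro exI[of _ \<F>]) simp
  qed
  show "fragmented_map T U f"
  proof (rule fragmented_map_if_almost_open_cover[OF T1])
    fix E assume "E \<in> U"
    then obtain \<F> where \<F>: "finite \<F>" "Y \<subseteq> \<Union>\<F>" "\<forall>C\<in>\<F>. C \<times> C \<subseteq> E \<and> C \<subseteq> Y \<and> Q C"
      using cover[OF \<open>E \<in> U\<close>] by (elim exE conjE) (rule that)
    show "\<exists>\<P>. finite \<P> \<and> topspace T \<subseteq> \<Union>\<P> \<and>
      (\<forall>P\<in>\<P>. f ` P \<times> f ` P \<subseteq> E \<and> finite (P - T interior_of P))"
    proof (intro exI[of _ "?pre ` \<F>"] conjI)
      show "finite (?pre ` \<F>)" using \<F> by simp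
      show "topspace T \<subseteq> \<Union>(?pre ` \<F>)" using f \<F>(2) by fastforce
      show "\<forall>P\<in>?pre ` \<F>. f ` P \<times> f ` P \<subseteq> E \<and> finite (P - T interior_of P)"
      proof (rule ballI, elim imageE, intro conjI)
        fix P C assume P: "P = ?pre C" and C: "C \<in> \<F>"
        have "f ` P \<subseteq> C" using P by auto
        then show "f ` P \<times> f ` P \<subseteq> E" using \<F>(3) C by blast
        show "finite (P - T interior_of P)" unfolding P using pre \<F>(3) C by simp
      qed
    qed
  qed
  assume T: "metrizable_space T" and "metrizable_uniformity Y U"
  then obtain E where E: "\<And>n::nat. E n \<in> U" "\<And>D. D \<in> U \<Longrightarrow> \<exists>n. E n \<subseteq> D"
    using metrizable_uniformity_countable_base[of Y U] by blast
  \<comment> \<open>Bundling the properties of a cover into one predicate lets \<open>choice\<close>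
    select a cover for every \<open>n\<close> simultaneously.\<close>
  define good where
    "good n \<F> \<longleftrightarrow> finite \<F> \<and> Y \<subseteq> \<Union>\<F> \<and> (\<forall>C\<in>\<F>. C \<times> C \<subseteq> E n \<and> C \<subseteq> Y \<and> Q C)" for n \<F>
  have "\<forall>n. \<exists>\<F>. good n \<F>" unfolding good_def using cover[OF E(1)] by simp
  then obtain \<F> where "\<forall>n. good n (\<F> n)" by (auto dest: choice)
  then have \<F>: "finite (\<F> n)" "Y \<subseteq> \<Union>(\<F> n)"
    "C \<in> \<F> n \<Longrightarrow> C \<times> C \<subseteq> E n \<and> C \<subseteq> Y \<and> Q C" for n C
    unfolding good_def by auto
  show "baire_class_one T (uniform_topology Y U) f"
    unfolding baire_class_one_def
  proof (intro allI impI)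
    fix V assume V: "openin (uniform_topology Y U) V"
    \<comment> \<open>The chosen sets inside \<open>V\<close> exhaust it: if \<open>E n\<close> {y}
      \<subseteq> V\<open>, then a member of\<close>\<F> n\<open>through\<close>y\<open>is\<close>E
      n\<open>-small, hence contained in\<close>E n \<open>{y}\<close> and so in
      \<open>V\<close>.\<close>
    define \<G> where "\<G> = {C \<in> (\<Union>n. \<F> n). C \<subseteq> V}"
    have "V \<subseteq> \<Union>\<G>"
    proof
      fix y assume "y \<in> V"
      then have "y \<in> Y" "\<exists>D\<in>U. D `` {y} \<subseteq> V"
        using V unfolding openin_uniform_topology[OF U(1)] by auto
      then obtain D where "D \<in> U" "D `` {y} \<subseteq> V" by blast
      then obtain n where n: "E n `` {y} \<subseteq> V" using E(2)[of D] by fast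
      obtain C where C: "C \<in> \<F> n" "y \<in> C" using \<F>(2)[of n] \<open>y \<in> Y\<close> by auto
      have "C \<subseteq> V" using \<F>(3)[OF C(1)] C(2) n by auto
      then show "y \<in> \<Union>\<G>" using C unfolding \<G>_def by auto
    qed
    moreover have "\<Union>\<G> \<subseteq> V" unfolding \<G>_def by auto
    ultimately have eq: "?pre V = \<Union>(?pre ` \<G>)" by auto
    have "countable (\<Union>n. \<F> n)"
      by (intro countable_UN) (simp_all add: countable_finite \<F>(1))
    then have "countable \<G>"
      unfolding \<G>_def by (rule countable_subset[rotated]) auto
    then have "fsigma_in T (\<Union>(?pre ` \<G>))"
    proof (intro fsigma_in_Union)
      show "fsigma_in T P" if P: "P \<in> ?pre ` \<G>" for P
      proof (rule fsigma_in_if_almost_open[OF T])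
        show "P \<subseteq> topspace T" using P by auto
        obtain C where C: "C \<in> \<G>" "P = ?pre C" using P by auto
        have "Q C" using C(1) \<F>(3) unfolding \<G>_def by auto
        then show "finite (P - T interior_of P)" unfolding C(2) using pre by simp
      qed
    qed simp
    then show "fsigma_in T (?pre V)" using eq by simp
  qed
qed

lemma infinite_three_points:
  assumes "infinite B"
  obtains a b c where "a \<in> B" "b \<in> B" "c \<in> B" "a \<noteq> b" "b \<noteq> c" "a \<noteq> c"
proof -
  obtain A where "A \<subseteq> B" "card A = 3" using assms infinite_arbitrarily_large by blast
  then show thesis using that by (auto simp: card_3_iff)
qed

section \<open>The circular case\<close>

lemma circular_order_onD:
  assumes "circular_order_on X R"
  shows "(a, b, c) \<in> R \<Longrightarrow> a \<in> X \<and> b \<in> X \<and> c \<in> X"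
    and "(a, b, c) \<in> R \<Longrightarrow> (b, c, a) \<in> R"
    and "(a, b, c) \<in> R \<Longrightarrow> (c, b, a) \<notin> R"
    and "(a, b, c) \<in> R \<Longrightarrow> (a, c, d) \<in> R \<Longrightarrow> (a, b, d) \<in> R"
    and "a \<in> X \<Longrightarrow> b \<in> X \<Longrightarrow> c \<in> X \<Longrightarrow> a \<noteq> b \<Longrightarrow> b \<noteq> c \<Longrightarrow> a \<noteq> c \<Longrightarrow>
      (a, b, c) \<in> R \<or> (a, c, b) \<in> R"
proof -
  note h1 = assms[unfolded circular_order_on_def]
  note h2 = conjunct2[OF h1]
  note h3 = conjunct2[OF h2]
  note h4 = conjunct2[OF h3]
  show "(a, b, c) \<in> R \<Longrightarrow> a \<in> X \<and> b \<in> X \<and> c \<in> X" using conjunct1[OF h1] by auto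
  show "(a, b, c) \<in> R \<Longrightarrow> (b, c, a) \<in> R" by (rule conjunct1[OF h2, rule_format])
  show "(a, b, c) \<in> R \<Longrightarrow> (c, b, a) \<notin> R" by (rule conjunct1[OF h3, rule_format])
  show "(a, b, c) \<in> R \<Longrightarrow> (a, c, d) \<in> R \<Longrightarrow> (a, b, d) \<in> R"
    by (rule conjunct1[OF h4, rule_format])
  show "a \<in> X \<Longrightarrow> b \<in> X \<Longrightarrow> c \<in> X \<Longrightarrow> a \<noteq> b \<Longrightarrow> b \<noteq> c \<Longrightarrow> a \<noteq> c \<Longrightarrow>
      (a, b, c) \<in> R \<or> (a, c, b) \<in> R"
    by (rule conjunct2[OF h4, rule_format])
qed

text \<open>If two entries agreed, some rotation of the triple would have equal outer entries and be
  its own reversal, against asymmetry.\<close>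

lemma circular_order_on_distinct:
  assumes "circular_order_on X R" "(a, b, c) \<in> R"
  shows "a \<noteq> b \<and> b \<noteq> c \<and> a \<noteq> c"
proof -
  note D = circular_order_onD(2,3)[OF assms(1)]
  have "(b, c, a) \<in> R" "(c, a, b) \<in> R" using D(1) assms(2) by blast+
  then show ?thesis using assms(2) D(2)[of a b c] D(2)[of b c a] D(2)[of c a b] by auto
qed

text \<open>By totality a point off \<open>a\<close> and \<open>b\<close> lies on exactly one of the
  two arcs. This identifies open arcs with the generating sets of the topology. For
  \<open>a = b\<close> the left side would be empty and the right side
  \<open>X - {a}\<close>.\<close>

lemma circ_open_interval_conv_Diff:
  assumes "circular_order_on X R" "a \<in> X" "b \<in> X" "a \<noteq> b"
  shows "circ_open_interval R a b = X - circ_closed_interval R b a"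
proof -
  note D = circular_order_onD[OF assms(1)]
  have "(a, x, b) \<in> R \<longleftrightarrow> x \<in> X \<and> (b, x, a) \<notin> R \<and> x \<noteq> a \<and> x \<noteq> b" for x
  proof
    assume x: "(a, x, b) \<in> R"
    show "x \<in> X \<and> (b, x, a) \<notin> R \<and> x \<noteq> a \<and> x \<noteq> b"
      using D(1)[OF x] D(3)[OF x] circular_order_on_distinct[OF assms(1) x] by auto
  next
    assume x: "x \<in> X \<and> (b, x, a) \<notin> R \<and> x \<noteq> a \<and> x \<noteq> b"
    then have "(b, a, x) \<in> R" using D(5)[of b x a] assms(2-4) by auto
    then show "(a, x, b) \<in> R" by (rule D(2))
  qed
  then show ?thesis unfolding circ_closed_interval_def circ_open_interval_def by auto
qed

lemma openin_circ_interval_topology: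
  assumes "a \<in> X" "b \<in> X"
  shows "openin (circ_interval_topology X R) (X - circ_closed_interval R a b)"
  unfolding circ_interval_topology_def
  using assms
  by (intro topology_generated_by_Basis insertI2 CollectI exI[of _ a] exI[of _ b] conjI refl)

text \<open>The embedding \<open>i\<close> is continuous and both preserves and reflects the order,
  so the preimage of the generating set with endpoints \<open>i a\<close>, \<open>i b\<close> is the
  one with endpoints \<open>a\<close>, \<open>b\<close>. Hence \<open>T\<close> refines the interval
  topology of \<open>R\<close> itself.\<close>

lemma gcots_openin:
  assumes "gcots TYPE('c) X R T" "a \<in> X" "b \<in> X"
  shows "openin T (X - circ_closed_interval R a b)"
proof -
  obtain Z :: "'c set" and S i where Z: "circular_order_on Z S" "i \<in> X \<rightarrow> Z" "inj_on i X"
    "embedding_map T (circ_interval_topology Z S) i" "topspace T = X" "circular_order_on X R"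
    "\<And>a b c. a \<in> X \<Longrightarrow> b \<in> X \<Longrightarrow> c \<in> X \<Longrightarrow> (a, b, c) \<in> R \<longleftrightarrow> (i a, i b, i c) \<in> S"
    using assms(1) unfolding gcots_def by blast
  have "continuous_map T (circ_interval_topology Z S) i"
    using Z(4) unfolding embedding_map_def
    by (blast dest: homeomorphic_imp_continuous_map continuous_map_into_fulltopology)
  moreover have "openin (circ_interval_topology Z S) (Z - circ_closed_interval S (i a) (i b))"
    using Z(2) assms by (intro openin_circ_interval_topology) blast+
  ultimately have "openin T {x \<in> topspace T. i x \<in> Z - circ_closed_interval S (i a) (i b)}"
    by (rule openin_continuous_map_preimage)
  moreover have "{x \<in> topspace T. i x \<in> Z - circ_closed_interval S (i a) (i b)}
      = X - circ_closed_interval R a b"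
    using Z assms(2,3) unfolding circ_closed_interval_def circ_open_interval_def
    by (auto dest: inj_onD)
  ultimately show ?thesis by simp
qed

text \<open>The degenerate closed interval from \<open>a\<close> to \<open>a\<close> is
  \<open>{a}\<close>, so complements of points are generating sets.\<close>

lemma gcots_t1_space:
  assumes "gcots TYPE('c) X R T"
  shows "t1_space T"
proof -
  have co: "circular_order_on X R" and X: "topspace T = X"
    using assms unfolding gcots_def by blast+
  have "closedin T {a}" if "a \<in> X" for a
  proof -
    have "circ_closed_interval R a a = {a}"
      using circular_order_on_distinct[OF co]
      unfolding circ_closed_interval_def circ_open_interval_def by blast
    then show ?thesis using gcots_openin[OF assms that that] X that
      by (simp add: closedin_def)
  qed
  then show ?thesis using X by (simp add: t1_space_closedin_singleton)
qed

text \<open>Three non-interior points \<open>a\<close>, \<open>b\<close>, \<open>c\<close> of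
  \<open>P\<close> in circular order are contradictory: convexity puts one of the two arcs between
  any two of them inside \<open>P\<close>, and an open arc inside \<open>P\<close> can contain no
  non-interior point.\<close>

lemma gcots_convex_almost_open:
  assumes "gcots TYPE('c) X R T" "circ_convex X R P"
  shows "finite (P - T interior_of P)"
proof (rule ccontr)
  assume "infinite (P - T interior_of P)" (is "infinite ?B")
  then obtain a b' c' where abc': "a \<in> ?B" "b' \<in> ?B" "c' \<in> ?B" "a \<noteq> b'" "b' \<noteq> c'" "a \<noteq> c'"
    using infinite_three_points by metis
  have co: "circular_order_on X R" and PX: "P \<subseteq> X"
    using assms unfolding gcots_def circ_convex_def by blast+
  note D = circular_order_onD[OF co]
  \<comment> \<open>Totality orients the three points, exchanging \<open>b'\<close> and
    \<open>c'\<close> if necessary.\<close>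
  obtain b c where abc: "a \<in> ?B" "b \<in> ?B" "c \<in> ?B" "(a, b, c) \<in> R"
    using abc' D(5)[of a b' c'] PX by blast
  have conv: "circ_open_interval R x y \<subseteq> P \<or> circ_open_interval R y x \<subseteq> P"
    if "x \<in> P" "y \<in> P" for x y
    using assms(2) that unfolding circ_convex_def circ_closed_interval_def by blast
  have no: "\<not> circ_open_interval R x y \<subseteq> P" if "x \<in> P" "y \<in> P" "(x, z, y) \<in> R" "z \<in> ?B" for x y z
  proof
    assume "circ_open_interval R x y \<subseteq> P"
    moreover have "openin T (circ_open_interval R x y)"
    proof -
      have "x \<in> X" "y \<in> X" "x \<noteq> y"
        using that(1,2) PX circular_order_on_distinct[OF co that(3)] by auto
      then show ?thesis
        using circ_open_interval_conv_Diff[OF co, of x y] gcots_openin[OF assms(1), of y x] by simp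
    qed
    ultimately have "circ_open_interval R x y \<subseteq> T interior_of P" by (rule interior_of_maximal)
    then show False using that(3,4) unfolding circ_open_interval_def by blast
  qed
  have rot: "(b, c, a) \<in> R" "(c, a, b) \<in> R" using abc D(2) by blast+
  \<comment> \<open>The arc from \<open>b\<close> to \<open>a\<close> contains \<open>c\<close>, and
    the arc from \<open>c\<close> to \<open>b\<close> contains \<open>a\<close>; both are excluded
    by \<open>no\<close>, so convexity selects the complementary arcs. Glued at \<open>b\<close>,
    these make up the arc from \<open>a\<close> to \<open>c\<close>, which contains
    \<open>b\<close>.\<close>
  have ab: "circ_open_interval R a b \<subseteq> P" and bc: "circ_open_interval R b c \<subseteq> P"
    using conv[of a b] conv[of b c] no[of b a c] no[of c b a] abc rot by blast+
  have "circ_open_interval R a c \<subseteq> P"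
  proof
    fix x assume "x \<in> circ_open_interval R a c"
    then have x: "(a, x, c) \<in> R" unfolding circ_open_interval_def by blast
    consider "x = b" | "(a, x, b) \<in> R" | "(a, b, x) \<in> R"
      using D(5)[of a x b] D(1)[OF x] D(1)[OF abc(4)] circular_order_on_distinct[OF co x]
        circular_order_on_distinct[OF co abc(4)] by auto
    then show "x \<in> P"
    proof cases
      case 3
      \<comment> \<open>Both triples are rotated to start at \<open>x\<close>, so that transitivity
        based at \<open>x\<close> removes \<open>a\<close>.\<close>
      have "(x, c, a) \<in> R" by (rule D(2)) (rule x)
      moreover have "(x, a, b) \<in> R" by (rule D(2), rule D(2)) (rule 3)
      ultimately have "(x, c, b) \<in> R" by (rule D(4))
      then have "(b, x, c) \<in> R" by (intro D(2)[of c b x] D(2)[of x c b])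
      then show ?thesis using bc unfolding circ_open_interval_def by auto
    qed (use ab abc in \<open>auto simp: circ_open_interval_def\<close>)
  qed
  then show False using no[of a c b] abc by blast
qed

text \<open>COP2 settles endpoints with equal values. For distinct values, the arc of the target
  contained in \<open>C\<close> dictates which arc of the source to take: an inner point either
  shares its value with an endpoint or is sent into that arc by COP1.\<close>

lemma cop_map_convex_preimage:
  assumes "circular_order_on X R" "cop_map X R Y S f" "circ_convex Y S C"
  shows "circ_convex X R {x \<in> X. f x \<in> C}"
proof -
  let ?P = "{x \<in> X. f x \<in> C}"
  have const: "circ_closed_interval R x y \<subseteq> ?P"
    if "x \<in> ?P" "y \<in> ?P" "f constant_on circ_closed_interval R x y" for x y
    using that circular_order_onD(1)[OF assms(1)]
    unfolding constant_on_def circ_closed_interval_def circ_open_interval_def by auto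
  have step: "circ_closed_interval R x y \<subseteq> ?P"
    if "x \<in> ?P" "y \<in> ?P" "f x \<noteq> f y" "circ_closed_interval S (f x) (f y) \<subseteq> C" for x y
  proof
    fix z assume z: "z \<in> circ_closed_interval R x y"
    show "z \<in> ?P"
    proof (cases "f z = f x \<or> f z = f y")
      case True
      then show ?thesis using that z circular_order_onD(1)[OF assms(1)]
        unfolding circ_closed_interval_def circ_open_interval_def by auto
    next
      case False
      then have "(x, z, y) \<in> R"
        using z unfolding circ_closed_interval_def circ_open_interval_def by auto
      then have "(f x, f z, f y) \<in> S" "z \<in> X"
        using assms(2) False that(3) circular_order_onD(1)[OF assms(1)]
        unfolding cop_map_def by metis+
      then show ?thesis using that(4)
        unfolding circ_closed_interval_def circ_open_interval_def by auto
    qed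
  qed
  show ?thesis
    unfolding circ_convex_def
  proof (intro conjI ballI)
    fix a b assume ab: "a \<in> ?P" "b \<in> ?P"
    show "circ_closed_interval R a b \<subseteq> ?P \<or> circ_closed_interval R b a \<subseteq> ?P"
    proof (cases "f a = f b")
      case True
      then have "f constant_on circ_closed_interval R a b \<or> f constant_on circ_closed_interval R b a"
        using ab assms(2) unfolding cop_map_def by blast
      then show ?thesis using const ab by blast
    next
      case False
      then show ?thesis using step[of a b] step[of b a] ab assms(3)
        unfolding circ_convex_def by auto
    qed
  qed blast
qed

section \<open>The linear case\<close>

lemma openin_lin_interval_topology:
  assumes "a \<in> X"
  shows "openin (lin_interval_topology X r) {x \<in> X. (x, a) \<in> r \<and> x \<noteq> a}"
    and "openin (lin_interval_topology X r) {x \<in> X. (a, x) \<in> r \<and> x \<noteq> a}"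
  unfolding lin_interval_topology_def
   apply (intro topology_generated_by_Basis insertI2 UnI1 CollectI exI[of _ a] conjI refl assms)
  apply (intro topology_generated_by_Basis insertI2 UnI2 CollectI exI[of _ a] conjI refl assms)
  done

lemma glots_openin:
  assumes "glots TYPE('c) X r T" "a \<in> X"
  shows "openin T {x \<in> X. (x, a) \<in> r \<and> x \<noteq> a}" "openin T {x \<in> X. (a, x) \<in> r \<and> x \<noteq> a}"
proof -
  obtain Z :: "'c set" and s i where Z: "i \<in> X \<rightarrow> Z" "inj_on i X"
    "embedding_map T (lin_interval_topology Z s) i" "topspace T = X"
    "\<And>a b. a \<in> X \<Longrightarrow> b \<in> X \<Longrightarrow> (a, b) \<in> r \<longleftrightarrow> (i a, i b) \<in> s"
    using assms(1) unfolding glots_def by blast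
  have cont: "continuous_map T (lin_interval_topology Z s) i"
    using Z(3) unfolding embedding_map_def
    by (blast dest: homeomorphic_imp_continuous_map continuous_map_into_fulltopology)
  have ia: "i a \<in> Z" using Z(1) assms(2) by blast
  have "{x \<in> X. (x, a) \<in> r \<and> x \<noteq> a}
      = {x \<in> topspace T. i x \<in> {z \<in> Z. (z, i a) \<in> s \<and> z \<noteq> i a}}"
    using Z assms(2) by (auto dest: inj_onD)
  then show "openin T {x \<in> X. (x, a) \<in> r \<and> x \<noteq> a}"
    using openin_continuous_map_preimage[OF cont openin_lin_interval_topology(1)[OF ia]] by simp
  have "{x \<in> X. (a, x) \<in> r \<and> x \<noteq> a}
      = {x \<in> topspace T. i x \<in> {z \<in> Z. (i a, z) \<in> s \<and> z \<noteq> i a}}"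
    using Z assms(2) by (auto dest: inj_onD)
  then show "openin T {x \<in> X. (a, x) \<in> r \<and> x \<noteq> a}"
    using openin_continuous_map_preimage[OF cont openin_lin_interval_topology(2)[OF ia]] by simp
qed

lemma glots_t1_space:
  assumes "glots TYPE('c) X r T"
  shows "t1_space T"
proof -
  have lo: "linear_order_on X r" and X: "topspace T = X"
    using assms unfolding glots_def by blast+
  have "closedin T {a}" if "a \<in> X" for a
  proof -
    have "X - {a} = {x \<in> X. (x, a) \<in> r \<and> x \<noteq> a} \<union> {x \<in> X. (a, x) \<in> r \<and> x \<noteq> a}"
      using lo that unfolding linear_order_on_def total_on_def by blast
    then show ?thesis
      using openin_Un[OF glots_openin[OF assms that]] X that by (simp add: closedin_def)
  qed
  then show ?thesis using X by (simp add: t1_space_closedin_singleton)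
qed

text \<open>Of three non-interior points, the middle one lies in the open interval between the outer
  two, which is an intersection of two open rays and is contained in \<open>P\<close> by
  convexity.\<close>

lemma glots_convex_almost_open:
  assumes "glots TYPE('c) X r T" "lin_convex X r P"
  shows "finite (P - T interior_of P)"
proof (rule ccontr)
  assume "infinite (P - T interior_of P)" (is "infinite ?B")
  then obtain x y z where xyz: "x \<in> ?B" "y \<in> ?B" "z \<in> ?B" "x \<noteq> y" "y \<noteq> z" "x \<noteq> z"
    using infinite_three_points by metis
  have lo: "linear_order_on X r" and PX: "P \<subseteq> X"
    using assms unfolding glots_def lin_convex_def by blast+
  have "(u, v) \<in> r \<or> (v, u) \<in> r" if "u \<in> ?B" "v \<in> ?B" "u \<noteq> v" for u v
    using lo PX that unfolding linear_order_on_def total_on_def by blast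
  \<comment> \<open>Whichever way the three pairs are ordered, two of the relations can be chained
    through a common middle point \<open>b\<close>.\<close>
  then obtain a b c where abc: "a \<in> ?B" "b \<in> ?B" "c \<in> ?B" "(a, b) \<in> r" "(b, c) \<in> r" "a \<noteq> b" "b \<noteq> c"
    using xyz by metis
  let ?W = "{x \<in> X. (a, x) \<in> r \<and> x \<noteq> a} \<inter> {x \<in> X. (x, c) \<in> r \<and> x \<noteq> c}"
  have "openin T ?W" using glots_openin[OF assms(1)] abc PX by blast
  moreover have "?W \<subseteq> P" using assms(2) abc unfolding lin_convex_def by blast
  ultimately have "?W \<subseteq> T interior_of P" by (simp add: interior_of_maximal)
  then show False using abc PX by blast
qed

lemma lop_map_convex_preimage:
  assumes "lop_map X r Y s f" "lin_convex Y s C"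
  shows "lin_convex X r {x \<in> X. f x \<in> C}"
  unfolding lin_convex_def
proof (intro conjI ballI impI)
  fix a b x assume "a \<in> {x \<in> X. f x \<in> C}" "b \<in> {x \<in> X. f x \<in> C}" "x \<in> X" "(a, x) \<in> r" "(x, b) \<in> r"
  moreover from this have "(f a, f x) \<in> s" "(f x, f b) \<in> s" "f x \<in> Y"
    using assms(1) unfolding lop_map_def by auto
  ultimately show "x \<in> {x \<in> X. f x \<in> C}"
    using assms(2) unfolding lin_convex_def by auto
qed auto

section \<open>Assembly of the circular and the linear case\<close>

theorem theorem11p4:
  fixes X :: "'a set" and T :: "'a topology"
    and Y :: "'b set" and \<mu> :: "'b rel set" and f :: "'a \<Rightarrow> 'b"
    and R :: "('a \<times> 'a \<times> 'a) set" and S :: "('b \<times> 'b \<times> 'b) set"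
    and r :: "'a rel" and s :: "'b rel"
  shows
    "(gcots TYPE('c) X R T \<and> circular_order_on Y S \<and>
      hausdorff_uniformity_on Y \<mu> \<and> precompact_uniformity Y \<mu> \<and> circ_convex_uniformity Y S \<mu> \<and>
      uniform_topology Y \<mu> = circ_interval_topology Y S \<and>
      cop_map X R Y S f
      \<longrightarrow> fragmented_map T \<mu> f \<and>
          (polish_topology T \<and> metrizable_uniformity Y \<mu> \<and> separable_uniformity Y \<mu>
           \<longrightarrow> baire_class_one T (circ_interval_topology Y S) f))
     \<and>
     (glots TYPE('c) X r T \<and> linear_order_on Y s \<and>
      hausdorff_uniformity_on Y \<mu> \<and> precompact_uniformity Y \<mu> \<and> lin_convex_uniformity Y s \<mu> \<and>
      uniform_topology Y \<mu> = lin_interval_topology Y s \<and>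
      lop_map X r Y s f
      \<longrightarrow> fragmented_map T \<mu> f \<and>
          (polish_topology T \<and> metrizable_uniformity Y \<mu> \<and> separable_uniformity Y \<mu>
           \<longrightarrow> baire_class_one T (lin_interval_topology Y s) f))"
proof (intro conjI impI; elim conjE)
  assume g: "gcots TYPE('c) X R T" and U: "hausdorff_uniformity_on Y \<mu>" "precompact_uniformity Y \<mu>"
    and conv: "circ_convex_uniformity Y S \<mu>"
    and top: "uniform_topology Y \<mu> = circ_interval_topology Y S" and f: "cop_map X R Y S f"
  have X: "topspace T = X" "circular_order_on X R" using g unfolding gcots_def by blast+
  obtain \<BB> where \<BB>: "uniform_cover_base Y \<mu> \<BB>" "\<forall>\<C>\<in>\<BB>. \<forall>C\<in>\<C>. circ_convex Y S C"
    using conv unfolding circ_convex_uniformity_def by blast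
  have u: "uniformity_on Y \<mu>" using U unfolding hausdorff_uniformity_on_def by blast
  have fX: "f \<in> topspace T \<rightarrow> Y" using f X unfolding cop_map_def by blast
  have pre: "\<forall>C. circ_convex Y S C \<longrightarrow>
      finite ({x \<in> topspace T. f x \<in> C} - T interior_of {x \<in> topspace T. f x \<in> C})"
    using gcots_convex_almost_open[OF g] cop_map_convex_preimage[OF X(2) f] X(1) by simp
  note main = fragmented_and_baire_if_almost_open_preimages
    [where Q = "circ_convex Y S", OF gcots_t1_space[OF g] fX u U(2) \<BB> pre]
  show "fragmented_map T \<mu> f" by (rule main(1))
  assume "polish_topology T" "metrizable_uniformity Y \<mu>"
  \<comment> \<open>Polishness supplies metrizability of \<open>T\<close>, which makes open sets
    F_sigma; \<open>top\<close> transfers the result from the uniform to the interval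
    topology.\<close>
  then show "baire_class_one T (circ_interval_topology Y S) f"
    using main(2) completely_metrizable_imp_metrizable_space
    unfolding top polish_topology_def by auto
next
  assume g: "glots TYPE('c) X r T" and U: "hausdorff_uniformity_on Y \<mu>" "precompact_uniformity Y \<mu>"
    and conv: "lin_convex_uniformity Y s \<mu>"
    and top: "uniform_topology Y \<mu> = lin_interval_topology Y s" and f: "lop_map X r Y s f"
  have X: "topspace T = X" using g unfolding glots_def by blast
  obtain \<BB> where \<BB>: "uniform_cover_base Y \<mu> \<BB>" "\<forall>\<C>\<in>\<BB>. \<forall>C\<in>\<C>. lin_convex Y s C"
    using conv unfolding lin_convex_uniformity_def by blast
  have u: "uniformity_on Y \<mu>" using U unfolding hausdorff_uniformity_on_def by blast
  have fX: "f \<in> topspace T \<rightarrow> Y" using f X unfolding lop_map_def by blast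
  have pre: "\<forall>C. lin_convex Y s C \<longrightarrow>
      finite ({x \<in> topspace T. f x \<in> C} - T interior_of {x \<in> topspace T. f x \<in> C})"
    using glots_convex_almost_open[OF g] lop_map_convex_preimage[OF f] X by simp
  note main = fragmented_and_baire_if_almost_open_preimages
    [where Q = "lin_convex Y s", OF glots_t1_space[OF g] fX u U(2) \<BB> pre]
  show "fragmented_map T \<mu> f" by (rule main(1))
  assume "polish_topology T" "metrizable_uniformity Y \<mu>"
  then show "baire_class_one T (lin_interval_topology Y s) f"
    using main(2) completely_metrizable_imp_metrizable_space
    unfolding top polish_topology_def by auto
qed

end
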